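(* Let $H(x,p)=\max_{i=1,2}\{p^2-b_i(x)p\}$, $b_-=\min\{b_1,b_2\}$, $b_+=\max\{b_1,b_2\}$. The Hamiltonian and its zero sublevel have the explicit forms $$H(x,p)=\begin{cases}p^2-b_-(x)p,&p\ge0,\\ p^2-b_+(x)p,&p\le0,\end{cases}\qquad\{p:H(x,p)\le0\}=[\min\{b_+(x),0\},\ \max\{b_-(x),0\}].$$ Moreover, for $x,\xi\in[\ell,r]$, $$d_H(x,\xi)=\begin{cases}\displaystyle\int_\xi^x(b_-(s))_+\,\mathrm ds,&x\ge\xi,\\[2mm]\displaystyle\int_x^\xi(-b_+(s))_+\,\mathrm ds,&x\le\xi.\end{cases}$$ The zero sublevel reduces to $\{0\}$ exactly on $\mathcal A_0:=\{x\in[\ell,r]:b_1(x)b_2(x)\le0\}$, and the full Neumann Aubry set is $$\mathcal A_N=\mathcal A_0\cup\{\ell:b_-(\ell)\le0\}\cup\{r:b_+(r)\ge0\}.$$ Every connected component of $\mathcal A_0$ is one static class, and every endpoint in $\mathcal A_N\setminus\mathcal A_0$ is an additional singleton static class.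
   Context: Setting: $\ell<r$ and $b_1,b_2\in C^1([\ell,r])$. Notation: $s_+=\max\{s,0\}$; $\{\ell:b_-(\ell)\le0\}$ means $\{\ell\}$ if $b_-(\ell)\le0$ and $\emptyset$ otherwise, and similarly at $r$. $\mathscr S_N$ denotes the set of Lipschitz viscosity subsolutions $u$ of $H(x,u')=0$ on $[\ell,r]$, including the subsolution part of the relaxed Neumann condition: if $\phi\in C^2([\ell,r])$ and $u-\phi$ has a local maximum at $x_0$ (relative to $[\ell,r]$), then $H(x_0,\phi'(x_0))\le0$ if $x_0\in(\ell,r)$ and $\min\{H(x_0,\phi'(x_0)),\partial_\nu\phi(x_0)\}\le0$ if $x_0\in\{\ell,r\}$, where $\partial_\nu\phi(\ell)=-\phi'(\ell)$, $\partial_\nu\phi(r)=\phi'(r)$. A supersolution satisfies: if $u-\phi$ has a local minimum at $x_0$, then $H(x_0,\phi'(x_0))\ge0$ if $x_0\in(\ell,r)$ and $\max\{H(x_0,\phi'(x_0)),\partial_\nu\phi(x_0)\}\ge0$ if $x_0\in\{\ell,r\}$. Define $d_H(x,y)=\sup_{u\in\mathscr S_N}\{u(x)-u(y)\}$. The Neumann Aubry set consists of the points $y\in[\ell,r]$ at which $d_H(\,\cdot\,,y)$ also satisfies the supersolution condition. Two Aubry points $x,y$ are in the same static class when $d_H(x,y)+d_H(y,x)=0$. *)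

theory Defs
  imports "HOL-Analysis.Analysis"
begin

text \<open>
  Continuous differentiability on a closed interval is taken with one-sided derivatives at the
  end points, since the functions are only given there; the library predicate
  \<open>C1_differentiable_on\<close> uses two-sided derivatives and so depends on values outside the set.
\<close>

definition has_C1_deriv_on :: "(real \<Rightarrow> real) \<Rightarrow> (real \<Rightarrow> real) \<Rightarrow> real set \<Rightarrow> bool" where
  "has_C1_deriv_on f f' S \<longleftrightarrow>
     (\<forall>x\<in>S. (f has_real_derivative f' x) (at x within S)) \<and> continuous_on S f'"

definition C1_on :: "real set \<Rightarrow> (real \<Rightarrow> real) \<Rightarrow> bool" where
  "C1_on S f \<longleftrightarrow> (\<exists>f'. has_C1_deriv_on f f' S)"

definition has_C2_deriv_on :: "(real \<Rightarrow> real) \<Rightarrow> (real \<Rightarrow> real) \<Rightarrow> real set \<Rightarrow> bool" where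
  "has_C2_deriv_on f f' S \<longleftrightarrow> has_C1_deriv_on f f' S \<and> C1_on S f'"

definition local_max_within :: "real set \<Rightarrow> (real \<Rightarrow> real) \<Rightarrow> real \<Rightarrow> bool" where
  "local_max_within S g x0 \<longleftrightarrow> (\<forall>\<^sub>F x in at x0 within S. g x \<le> g x0)"

definition local_min_within :: "real set \<Rightarrow> (real \<Rightarrow> real) \<Rightarrow> real \<Rightarrow> bool" where
  "local_min_within S g x0 \<longleftrightarrow> (\<forall>\<^sub>F x in at x0 within S. g x0 \<le> g x)"

text \<open>
  The outward normal derivative at an end point \<open>x\<close> of \<open>[l, r]\<close> of a function with slope \<open>p\<close>
  there; used only for \<open>x \<in> {l, r}\<close>.
\<close>

definition normal_deriv :: "real \<Rightarrow> real \<Rightarrow> real \<Rightarrow> real" where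
  "normal_deriv l x p = (if x = l then - p else p)"

definition neumann_subsolution ::
    "real \<Rightarrow> real \<Rightarrow> (real \<Rightarrow> real \<Rightarrow> real) \<Rightarrow> (real \<Rightarrow> real) \<Rightarrow> bool" where
  "neumann_subsolution l r H u \<longleftrightarrow>
     (\<forall>\<phi> \<phi>'. has_C2_deriv_on \<phi> \<phi>' {l..r} \<longrightarrow>
       (\<forall>x0\<in>{l..r}. local_max_within {l..r} (\<lambda>x. u x - \<phi> x) x0 \<longrightarrow>
          (x0 \<in> {l<..<r} \<longrightarrow> H x0 (\<phi>' x0) \<le> 0) \<and>
          (x0 \<in> {l, r} \<longrightarrow> min (H x0 (\<phi>' x0)) (normal_deriv l x0 (\<phi>' x0)) \<le> 0)))"

definition neumann_supersolution ::
    "real \<Rightarrow> real \<Rightarrow> (real \<Rightarrow> real \<Rightarrow> real) \<Rightarrow> (real \<Rightarrow> real) \<Rightarrow> bool" where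
  "neumann_supersolution l r H u \<longleftrightarrow>
     (\<forall>\<phi> \<phi>'. has_C2_deriv_on \<phi> \<phi>' {l..r} \<longrightarrow>
       (\<forall>x0\<in>{l..r}. local_min_within {l..r} (\<lambda>x. u x - \<phi> x) x0 \<longrightarrow>
          (x0 \<in> {l<..<r} \<longrightarrow> H x0 (\<phi>' x0) \<ge> 0) \<and>
          (x0 \<in> {l, r} \<longrightarrow> max (H x0 (\<phi>' x0)) (normal_deriv l x0 (\<phi>' x0)) \<ge> 0)))"

definition lipschitz_subsolutions ::
    "real \<Rightarrow> real \<Rightarrow> (real \<Rightarrow> real \<Rightarrow> real) \<Rightarrow> (real \<Rightarrow> real) set" where
  "lipschitz_subsolutions l r H =
     {u. (\<exists>L. L-lipschitz_on {l..r} u) \<and> neumann_subsolution l r H u}"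

text \<open>
  The supremum is taken in the extended reals, so that it is meaningful without knowing in advance
  that it is finite.
\<close>

definition intrinsic_dist ::
    "real \<Rightarrow> real \<Rightarrow> (real \<Rightarrow> real \<Rightarrow> real) \<Rightarrow> real \<Rightarrow> real \<Rightarrow> ereal" where
  "intrinsic_dist l r H x y = (SUP u\<in>lipschitz_subsolutions l r H. ereal (u x - u y))"

definition neumann_aubry :: "real \<Rightarrow> real \<Rightarrow> (real \<Rightarrow> real \<Rightarrow> real) \<Rightarrow> real set" where
  "neumann_aubry l r H =
     {y\<in>{l..r}. (\<forall>x\<in>{l..r}. \<bar>intrinsic_dist l r H x y\<bar> \<noteq> \<infinity>) \<and>
        neumann_supersolution l r H (\<lambda>x. real_of_ereal (intrinsic_dist l r H x y))}"

definition static_classes :: "real \<Rightarrow> real \<Rightarrow> (real \<Rightarrow> real \<Rightarrow> real) \<Rightarrow> real set set" where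
  "static_classes l r H =
     neumann_aubry l r H //
       {(x, y). x \<in> neumann_aubry l r H \<and> y \<in> neumann_aubry l r H \<and>
                intrinsic_dist l r H x y + intrinsic_dist l r H y x = 0}"

definition max_hamiltonian ::
    "(real \<Rightarrow> real) \<Rightarrow> (real \<Rightarrow> real) \<Rightarrow> real \<Rightarrow> real \<Rightarrow> real" where
  "max_hamiltonian b1 b2 x p = max (p\<^sup>2 - b1 x * p) (p\<^sup>2 - b2 x * p)"

definition b_minus :: "(real \<Rightarrow> real) \<Rightarrow> (real \<Rightarrow> real) \<Rightarrow> real \<Rightarrow> real" where
  "b_minus b1 b2 x = min (b1 x) (b2 x)"

definition b_plus :: "(real \<Rightarrow> real) \<Rightarrow> (real \<Rightarrow> real) \<Rightarrow> real \<Rightarrow> real" where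
  "b_plus b1 b2 x = max (b1 x) (b2 x)"

definition A_zero :: "real \<Rightarrow> real \<Rightarrow> (real \<Rightarrow> real) \<Rightarrow> (real \<Rightarrow> real) \<Rightarrow> real set" where
  "A_zero l r b1 b2 = {x\<in>{l..r}. b1 x * b2 x \<le> 0}"

end

theory Submission
  imports Defs
begin

text \<open>
  Only two features of the Hamiltonian matter: at each point \<open>x\<close> the sublevel \<open>H x p \<le> 0\<close> is an
  interval \<open>[- N x, P x]\<close> that contains \<open>0\<close> and depends continuously on \<open>x\<close>, and \<open>H x p < 0\<close>
  exactly in its interior.  For the maximum of the two quadratic Hamiltonians,
  \<open>P = max b\<^sub>- 0\<close> and \<open>N = max (- b\<^sub>+) 0\<close>.

  For a subsolution \<open>u\<close> the differences \<open>u x - u y\<close>, \<open>y \<le> x\<close>, are at most the integral of \<open>P\<close>: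
  choose a \<open>C\<^sup>2\<close> function \<open>\<phi>\<close> with \<open>P < \<phi>' < P + \<epsilon>\<close>.  If \<open>u - \<phi>\<close> were not nonincreasing, it would
  have a maximum over some \<open>[a, r]\<close> away from \<open>a\<close>, and there the subsolution property fails; the
  relaxed Neumann condition does not help at \<open>r\<close>, because \<open>\<phi>' > P \<ge> 0\<close>.  The bound by \<open>N\<close> in the other
  direction is symmetric.  Both bounds are attained, because every primitive of a continuous
  function with values in \<open>[- N, P]\<close> is a subsolution.  This gives the formula for the distance
  (\<open>intrinsic_dist_eq\<close>).

  The distance from \<open>y\<close> has slope \<open>- N\<close> to the left of \<open>y\<close> and \<open>P\<close> to the right of it.  Away from
  \<open>y\<close> these slopes are not in the interior of the sublevel, and at an end point other than \<open>y\<close>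
  every test function touching from below has an outward (or zero) slope, which the relaxed Neumann
  condition admits.  So the supersolution property can only fail at \<open>y\<close>, where every slope strictly
  inside \<open>[- N y, P y]\<close> belongs to a test function touching from below; it fails exactly if there is
  such a slope and, when \<open>y\<close> is an end point, one that points inwards
  (\<open>neumann_aubry_eq\<close>).  Finally \<open>d x y + d y x\<close> is the integral of \<open>N + P\<close> between \<open>x\<close>
  and \<open>y\<close>, which vanishes exactly if \<open>N = P = 0\<close> on the whole segment; this identifies the static
  classes.
\<close>

section \<open>One-sided derivatives and local extrema\<close>

lemma right_deriv_nonneg_of_min:
  fixes g :: "real \<Rightarrow> real"
  assumes d: "(g has_real_derivative d) (at x within {x..r})" and "x < r"
    and ev: "\<forall>\<^sub>F z in at x within {x..r}. g x \<le> g z"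
  shows "0 \<le> d"
proof (rule tendsto_lowerbound)
  show "((\<lambda>z. (g z - g x) / (z - x)) \<longlongrightarrow> d) (at x within {x..r})"
    using d by (simp add: has_field_derivative_iff)
  have "\<forall>\<^sub>F z in at x within {x..r}. z \<in> {x..r}"
    by (simp add: eventually_at_filter)
  then show "\<forall>\<^sub>F z in at x within {x..r}. 0 \<le> (g z - g x) / (z - x)"
    using ev by eventually_elim auto
  show "at x within {x..r} \<noteq> bot"
    using \<open>x < r\<close> by (simp add: trivial_limit_within islimpt_Icc)
qed

lemma left_deriv_nonpos_of_min:
  fixes g :: "real \<Rightarrow> real"
  assumes d: "(g has_real_derivative d) (at x within {l..x})" and "l < x"
    and ev: "\<forall>\<^sub>F z in at x within {l..x}. g x \<le> g z"
  shows "d \<le> 0"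
proof (rule tendsto_upperbound)
  show "((\<lambda>z. (g z - g x) / (z - x)) \<longlongrightarrow> d) (at x within {l..x})"
    using d by (simp add: has_field_derivative_iff)
  have "\<forall>\<^sub>F z in at x within {l..x}. z \<in> {l..x}"
    by (simp add: eventually_at_filter)
  then show "\<forall>\<^sub>F z in at x within {l..x}. (g z - g x) / (z - x) \<le> 0"
    using ev by eventually_elim (auto simp: divide_nonneg_nonpos)
  show "at x within {l..x} \<noteq> bot"
    using \<open>l < x\<close> by (simp add: trivial_limit_within islimpt_Icc)
qed

lemma right_min_of_deriv_pos:
  fixes g :: "real \<Rightarrow> real"
  assumes d: "(g has_real_derivative d) (at x within {x..r})" and "0 < d"
  shows "\<forall>\<^sub>F z in at x within {x..r}. g x \<le> g z"
proof -
  have "((\<lambda>z. (g z - g x) / (z - x)) \<longlongrightarrow> d) (at x within {x..r})"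
    using d by (simp add: has_field_derivative_iff)
  then have "\<forall>\<^sub>F z in at x within {x..r}. 0 < (g z - g x) / (z - x)"
    using \<open>0 < d\<close> by (rule order_tendstoD)
  moreover have "\<forall>\<^sub>F z in at x within {x..r}. z \<in> {x..r}"
    by (simp add: eventually_at_filter)
  ultimately show ?thesis
    by eventually_elim (auto simp: zero_less_divide_iff)
qed

lemma left_min_of_deriv_neg:
  fixes g :: "real \<Rightarrow> real"
  assumes d: "(g has_real_derivative d) (at x within {l..x})" and "d < 0"
  shows "\<forall>\<^sub>F z in at x within {l..x}. g x \<le> g z"
proof -
  have "((\<lambda>z. (g z - g x) / (z - x)) \<longlongrightarrow> d) (at x within {l..x})"
    using d by (simp add: has_field_derivative_iff)
  then have "\<forall>\<^sub>F z in at x within {l..x}. (g z - g x) / (z - x) < 0"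
    using \<open>d < 0\<close> by (rule order_tendstoD)
  moreover have "\<forall>\<^sub>F z in at x within {l..x}. z \<in> {l..x}"
    by (simp add: eventually_at_filter)
  ultimately show ?thesis
    by eventually_elim (auto simp: divide_less_0_iff)
qed

lemma local_min_within_Icc_iff:
  fixes g :: "real \<Rightarrow> real"
  assumes "x \<in> {l..r}"
  shows "local_min_within {l..r} g x \<longleftrightarrow>
    (\<forall>\<^sub>F z in at x within {l..x}. g x \<le> g z) \<and> (\<forall>\<^sub>F z in at x within {x..r}. g x \<le> g z)"
proof -
  have "{l..r} = {l..x} \<union> {x..r}"
    using assms by auto
  then have "at x within {l..r} = sup (at x within {l..x}) (at x within {x..r})"
    by (simp add: at_within_union)
  then show ?thesis
    by (simp add: local_min_within_def eventually_sup)
qed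

lemma test_slope_le_right_deriv:
  assumes "local_min_within {l..r} (\<lambda>z. u z - \<phi> z) x" "x \<in> {l..r}" "x < r"
    and u: "(u has_real_derivative s) (at x within {x..r})"
    and \<phi>: "(\<phi> has_real_derivative p) (at x within {l..r})"
  shows "p \<le> s"
proof -
  have "(\<phi> has_real_derivative p) (at x within {x..r})"
    using \<phi> by (rule DERIV_subset) (use assms(2) in auto)
  then have "((\<lambda>z. u z - \<phi> z) has_real_derivative s - p) (at x within {x..r})"
    using u by (intro DERIV_diff)
  then have "0 \<le> s - p"
    using assms(1-3) by (intro right_deriv_nonneg_of_min) (auto simp: local_min_within_Icc_iff)
  then show ?thesis by simp
qed

lemma left_deriv_le_test_slope:
  assumes "local_min_within {l..r} (\<lambda>z. u z - \<phi> z) x" "x \<in> {l..r}" "l < x"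
    and u: "(u has_real_derivative s) (at x within {l..x})"
    and \<phi>: "(\<phi> has_real_derivative p) (at x within {l..r})"
  shows "s \<le> p"
proof -
  have "(\<phi> has_real_derivative p) (at x within {l..x})"
    using \<phi> by (rule DERIV_subset) (use assms(2) in auto)
  then have "((\<lambda>z. u z - \<phi> z) has_real_derivative s - p) (at x within {l..x})"
    using u by (intro DERIV_diff)
  then have "s - p \<le> 0"
    using assms(1-3) by (intro left_deriv_nonpos_of_min) (auto simp: local_min_within_Icc_iff)
  then show ?thesis by simp
qed

lemma local_max_within_iff_min:
  "local_max_within S (\<lambda>z. u z - \<phi> z) x \<longleftrightarrow> local_min_within S (\<lambda>z. - u z - (- \<phi> z)) x"
  by (simp add: local_max_within_def local_min_within_def algebra_simps)

lemma local_max_within_of_max_on: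
  fixes g :: "real \<Rightarrow> real"
  assumes "c \<in> T" "open U" "c \<in> U" "U \<inter> S \<subseteq> T" "\<And>z. z \<in> T \<Longrightarrow> g z \<le> g c"
  shows "local_max_within S g c"
  using assms unfolding local_max_within_def eventually_at_topological by blast

lemma neumann_supersolution_cong:
  assumes "\<And>x. x \<in> {l..r} \<Longrightarrow> u x = v x"
  shows "neumann_supersolution l r H u \<longleftrightarrow> neumann_supersolution l r H v"
proof -
  have "local_min_within {l..r} (\<lambda>x. u x - \<phi> x) c \<longleftrightarrow> local_min_within {l..r} (\<lambda>x. v x - \<phi> x) c"
    if "c \<in> {l..r}" for \<phi> c
    unfolding local_min_within_def eventually_at_filter
    by (rule eventually_cong[OF always_eventually]) (use assms that in auto)
  then show ?thesis
    unfolding neumann_supersolution_def by auto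
qed

section \<open>Test functions with prescribed slope\<close>

lemma has_C2_deriv_on_linear: "has_C2_deriv_on (\<lambda>x. p * x) (\<lambda>x. p) S"
  unfolding has_C2_deriv_on_def C1_on_def has_C1_deriv_on_def
  by (auto intro!: derivative_eq_intros exI[of _ "\<lambda>x. 0"])

lemma has_C1_deriv_on_minus:
  "has_C1_deriv_on f f' S \<Longrightarrow> has_C1_deriv_on (\<lambda>x. - f x) (\<lambda>x. - f' x) S"
  unfolding has_C1_deriv_on_def by (simp add: DERIV_minus continuous_on_minus)

lemma C1_on_minus: "C1_on S f \<Longrightarrow> C1_on S (\<lambda>x. - f x)"
  unfolding C1_on_def using has_C1_deriv_on_minus by blast

lemma integral_has_deriv_Icc:
  fixes f :: "real \<Rightarrow> real"
  assumes "continuous_on {l..r} f" "x \<in> {l..r}"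
  shows "((\<lambda>x. integral {l..x} f) has_real_derivative f x) (at x within {l..r})"
  using integral_has_real_derivative[OF assms] .

lemma integral_diff_Icc:
  fixes f :: "real \<Rightarrow> real"
  assumes "continuous_on {l..r} f" "l \<le> y" "y \<le> x" "x \<le> r"
  shows "integral {l..x} f - integral {l..y} f = integral {y..x} f"
proof -
  have "continuous_on {l..x} f"
    using assms(1) by (rule continuous_on_subset) (use assms in auto)
  then have "integral {l..y} f + integral {y..x} f = integral {l..x} f"
    using assms by (intro Henstock_Kurzweil_Integration.integral_combine)
      (auto intro: integrable_continuous_interval)
  then show ?thesis by simp
qed

text \<open>
  A continuous function lies just below the slope of some \<open>C\<^sup>2\<close> function: take the primitive of a
  polynomial from the Weierstrass approximation theorem, shifted upwards.
\<close>

lemma C2_slope_slightly_above: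
  fixes f :: "real \<Rightarrow> real"
  assumes f: "continuous_on {l..r} f" and "0 < \<epsilon>"
  obtains \<phi> \<phi>' where "has_C2_deriv_on \<phi> \<phi>' {l..r}"
    and "\<And>x. x \<in> {l..r} \<Longrightarrow> f x < \<phi>' x"
    and "\<And>x y. l \<le> y \<Longrightarrow> y \<le> x \<Longrightarrow> x \<le> r \<Longrightarrow> \<phi> x - \<phi> y \<le> integral {y..x} f + \<epsilon> * (x - y)"
proof -
  obtain g where g: "polynomial_function g" "\<And>x. x \<in> {l..r} \<Longrightarrow> norm (f x - g x) < \<epsilon> / 2"
    using Stone_Weierstrass_polynomial_function[OF compact_Icc f, of "\<epsilon> / 2"] \<open>0 < \<epsilon>\<close> by auto
  obtain g' where g': "polynomial_function g'" "\<And>x. (g has_vector_derivative g' x) (at x)"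
    using has_vector_derivative_polynomial_function[OF g(1)] by metis
  define q where "q = (\<lambda>x. g x + \<epsilon> / 2)"
  define \<phi> where "\<phi> = (\<lambda>x. integral {l..x} q)"
  have q_lower: "f x < q x" and q_upper: "q x \<le> f x + \<epsilon>" if "x \<in> {l..r}" for x
    using g(2)[OF that] unfolding q_def real_norm_def by linarith+
  have q_cont: "continuous_on {l..r} q"
    unfolding q_def using g(1) by (intro continuous_intros continuous_on_polymonial_function)
  have "C1_on {l..r} q"
    unfolding C1_on_def has_C1_deriv_on_def q_def
  proof (intro exI[of _ g'] conjI ballI)
    fix x
    have "(g has_real_derivative g' x) (at x within {l..r})"
      using g'(2) by (simp add: has_real_derivative_iff_has_vector_derivative
          has_vector_derivative_at_within)
    then show "((\<lambda>x. g x + \<epsilon> / 2) has_real_derivative g' x) (at x within {l..r})"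
      by (auto intro!: derivative_eq_intros)
  qed (use g'(1) in \<open>intro continuous_on_polymonial_function\<close>)
  then have "has_C2_deriv_on \<phi> q {l..r}"
    unfolding has_C2_deriv_on_def has_C1_deriv_on_def \<phi>_def
    using q_cont integral_has_deriv_Icc[OF q_cont] by auto
  moreover have "\<phi> x - \<phi> y \<le> integral {y..x} f + \<epsilon> * (x - y)"
    if "l \<le> y" "y \<le> x" "x \<le> r" for x y
  proof -
    have sub: "{y..x} \<subseteq> {l..r}" using that by auto
    have "\<phi> x - \<phi> y = integral {y..x} q"
      unfolding \<phi>_def using q_cont that by (rule integral_diff_Icc)
    also have "\<dots> \<le> integral {y..x} (\<lambda>z. f z + \<epsilon>)"
      by (rule integral_le)
        (use sub q_upper in \<open>auto intro!: integrable_continuous_interval continuous_intros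
           continuous_on_subset[OF q_cont] continuous_on_subset[OF f]\<close>)
    also have "\<dots> = integral {y..x} f + integral {y..x} (\<lambda>z. \<epsilon>)"
      by (rule Henstock_Kurzweil_Integration.integral_add)
        (use sub in \<open>auto intro!: integrable_continuous_interval continuous_on_subset[OF f]\<close>)
    finally show ?thesis using that by (simp add: mult.commute)
  qed
  ultimately show ?thesis using that q_lower by blast
qed

lemma C2_slope_slightly_below:
  fixes f :: "real \<Rightarrow> real"
  assumes f: "continuous_on {l..r} f" and "0 < \<epsilon>"
  obtains \<phi> \<phi>' where "has_C2_deriv_on \<phi> \<phi>' {l..r}"
    and "\<And>x. x \<in> {l..r} \<Longrightarrow> \<phi>' x < - f x"
    and "\<And>x y. l \<le> y \<Longrightarrow> y \<le> x \<Longrightarrow> x \<le> r \<Longrightarrow> \<phi> y - \<phi> x \<le> integral {y..x} f + \<epsilon> * (x - y)"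
proof -
  obtain \<phi> \<phi>' where *: "has_C2_deriv_on \<phi> \<phi>' {l..r}"
    "\<And>x. x \<in> {l..r} \<Longrightarrow> f x < \<phi>' x"
    "\<And>x y. l \<le> y \<Longrightarrow> y \<le> x \<Longrightarrow> x \<le> r \<Longrightarrow> \<phi> x - \<phi> y \<le> integral {y..x} f + \<epsilon> * (x - y)"
    using C2_slope_slightly_above[OF assms] by blast
  have "has_C2_deriv_on (\<lambda>x. - \<phi> x) (\<lambda>x. - \<phi>' x) {l..r}"
    using *(1) C1_on_minus[of "{l..r}" \<phi>'] has_C1_deriv_on_minus[of \<phi> \<phi>' "{l..r}"]
    unfolding has_C2_deriv_on_def by blast
  then show ?thesis
    using *(2,3) by (intro that[of "\<lambda>x. - \<phi> x" "\<lambda>x. - \<phi>' x"]) auto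
qed

section \<open>Hamiltonians with interval sublevels\<close>

text \<open>
  A Hamiltonian on \<open>[l, r]\<close> with zero sublevel \<open>[- N x, P x] \<ni> 0\<close> at \<open>x\<close>, negative exactly in the
  interior of that interval.
\<close>

locale interval_hamiltonian =
  fixes l r :: real and H :: "real \<Rightarrow> real \<Rightarrow> real" and N P :: "real \<Rightarrow> real"
  assumes lr: "l < r"
    and contN: "continuous_on {l..r} N" and contP: "continuous_on {l..r} P"
    and N_nonneg: "x \<in> {l..r} \<Longrightarrow> 0 \<le> N x" and P_nonneg: "x \<in> {l..r} \<Longrightarrow> 0 \<le> P x"
    and H_nonpos_iff: "x \<in> {l..r} \<Longrightarrow> H x p \<le> 0 \<longleftrightarrow> - N x \<le> p \<and> p \<le> P x"
    and H_neg_iff: "x \<in> {l..r} \<Longrightarrow> H x p < 0 \<longleftrightarrow> - N x < p \<and> p < P x"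
begin

subsection \<open>The intrinsic distance\<close>

lemma primitive_subsolution:
  assumes cont: "continuous_on {l..r} f"
    and bounds: "\<And>x. x \<in> {l..r} \<Longrightarrow> - N x \<le> f x \<and> f x \<le> P x"
  shows "(\<lambda>x. integral {l..x} f) \<in> lipschitz_subsolutions l r H"
proof -
  let ?u = "\<lambda>x. integral {l..x} f"
  have deriv: "(?u has_real_derivative f x) (at x within {l..r})" if "x \<in> {l..r}" for x
    using integral_has_deriv_Icc[OF cont that] .
  have "bounded (f ` {l..r})"
    using compact_continuous_image[OF cont compact_Icc] by (rule compact_imp_bounded)
  then obtain B where B: "\<And>x. x \<in> {l..r} \<Longrightarrow> \<bar>f x\<bar> \<le> B" "0 \<le> B"
    unfolding bounded_pos by (metis image_eqI less_imp_le real_norm_def)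
  have "B-lipschitz_on {l..r} ?u"
  proof (rule lipschitz_onI)
    fix x y assume xy: "x \<in> {l..r}" "y \<in> {l..r}"
    have "norm (?u x - ?u y) \<le> B * norm (x - y)"
      by (rule field_differentiable_bound[of "{l..r}" ?u f]) (use deriv B xy in auto)
    then show "dist (?u x) (?u y) \<le> B * dist x y"
      by (simp add: dist_norm)
  qed (use B in auto)
  moreover have "neumann_subsolution l r H ?u"
    unfolding neumann_subsolution_def
  proof (intro allI impI ballI)
    fix \<phi> \<phi>' c
    assume C2: "has_C2_deriv_on \<phi> \<phi>' {l..r}" and c: "c \<in> {l..r}"
      and max: "local_max_within {l..r} (\<lambda>x. ?u x - \<phi> x) c"
    have \<phi>: "((\<lambda>x. - \<phi> x) has_real_derivative - \<phi>' c) (at c within {l..r})"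
      using C2 c unfolding has_C2_deriv_on_def has_C1_deriv_on_def by (auto intro: DERIV_minus)
    have min: "local_min_within {l..r} (\<lambda>x. - ?u x - (- \<phi> x)) c"
      using max by (simp add: local_max_within_iff_min)
    have u: "((\<lambda>x. - ?u x) has_real_derivative - f c) (at c within T)" if "T \<subseteq> {l..r}" for T
      using deriv[OF c] that by (intro DERIV_minus) (rule DERIV_subset)
    have right: "f c \<le> \<phi>' c" if "c < r"
      using test_slope_le_right_deriv[OF min c that u \<phi>] c by auto
    have left: "\<phi>' c \<le> f c" if "l < c"
      using left_deriv_le_test_slope[OF min c that u \<phi>] c by auto
    show "(c \<in> {l<..<r} \<longrightarrow> H c (\<phi>' c) \<le> 0) \<and>
      (c \<in> {l, r} \<longrightarrow> min (H c (\<phi>' c)) (normal_deriv l c (\<phi>' c)) \<le> 0)"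
    proof (intro conjI impI)
      assume "c \<in> {l<..<r}"
      then show "H c (\<phi>' c) \<le> 0"
        using left right bounds[OF c] c by (auto simp: H_nonpos_iff)
    next
      assume "c \<in> {l, r}"
      then consider "c = l" | "c = r" by auto
      then show "min (H c (\<phi>' c)) (normal_deriv l c (\<phi>' c)) \<le> 0"
      proof cases
        case 1
        \<comment> \<open>A negative test slope lies between \<open>f c\<close> and \<open>0\<close>, hence in the sublevel.\<close>
        then have "H c (\<phi>' c) \<le> 0" if "\<phi>' c < 0"
          using that right bounds[OF c] P_nonneg[OF c] c lr by (auto simp: H_nonpos_iff)
        then show ?thesis using 1 by (auto simp: normal_deriv_def min_le_iff_disj not_less)
      next
        case 2
        then have "H c (\<phi>' c) \<le> 0" if "0 < \<phi>' c"
          using that left bounds[OF c] N_nonneg[OF c] c lr by (auto simp: H_nonpos_iff)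
        then show ?thesis using 2 lr by (auto simp: normal_deriv_def min_le_iff_disj not_less)
      qed
    qed
  qed
  ultimately show ?thesis
    unfolding lipschitz_subsolutions_def by blast
qed

lemma subsolution_increase_le:
  assumes u: "u \<in> lipschitz_subsolutions l r H" and "l \<le> a" "a \<le> b" "b \<le> r"
  shows "u b - u a \<le> integral {a..b} P"
proof (rule field_le_epsilon)
  fix e :: real assume "0 < e"
  define \<epsilon> where "\<epsilon> = e / (b - a + 1)"
  have "0 < \<epsilon>" "\<epsilon> * (b - a) \<le> e"
    using \<open>0 < e\<close> \<open>a \<le> b\<close> by (auto simp: \<epsilon>_def field_simps)
  obtain \<phi> \<phi>' where C2: "has_C2_deriv_on \<phi> \<phi>' {l..r}"
    and slope: "\<And>x. x \<in> {l..r} \<Longrightarrow> P x < \<phi>' x"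
    and incr: "\<And>x y. l \<le> y \<Longrightarrow> y \<le> x \<Longrightarrow> x \<le> r \<Longrightarrow> \<phi> x - \<phi> y \<le> integral {y..x} P + \<epsilon> * (x - y)"
    using C2_slope_slightly_above[OF contP \<open>0 < \<epsilon>\<close>] by blast
  have u_cont: "continuous_on {l..r} u" and sub: "neumann_subsolution l r H u"
    using u unfolding lipschitz_subsolutions_def by (auto intro: lipschitz_on_continuous_on)
  have \<phi>_cont: "continuous_on {l..r} \<phi>"
    using C2 unfolding has_C2_deriv_on_def has_C1_deriv_on_def by (meson DERIV_continuous_on)
  have "u b - \<phi> b \<le> u a - \<phi> a"
  proof (rule ccontr)
    assume less: "\<not> u b - \<phi> b \<le> u a - \<phi> a"
    have "continuous_on {a..r} (\<lambda>x. u x - \<phi> x)"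
      by (rule continuous_on_subset[OF continuous_on_diff[OF u_cont \<phi>_cont]]) (use assms in auto)
    then obtain c where c: "c \<in> {a..r}" "\<And>z. z \<in> {a..r} \<Longrightarrow> u z - \<phi> z \<le> u c - \<phi> c"
      using continuous_attains_sup[OF compact_Icc, of a r "\<lambda>x. u x - \<phi> x"] assms by force
    have "a < c"
      using c(2)[of b] c(1) less assms by (cases "c = a") auto
    then have cl: "c \<in> {l..r}" "l < c" using c(1) assms by auto
    have "local_max_within {l..r} (\<lambda>x. u x - \<phi> x) c"
      by (rule local_max_within_of_max_on[of c "{a..r}" "{a<..}"]) (use c \<open>a < c\<close> in auto)
    then have "(c \<in> {l<..<r} \<longrightarrow> H c (\<phi>' c) \<le> 0) \<and>
      (c \<in> {l, r} \<longrightarrow> min (H c (\<phi>' c)) (normal_deriv l c (\<phi>' c)) \<le> 0)"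
      using sub C2 cl unfolding neumann_subsolution_def by blast
    moreover have "0 < \<phi>' c" "\<not> H c (\<phi>' c) \<le> 0"
      using slope[OF cl(1)] P_nonneg[OF cl(1)] by (auto simp: H_nonpos_iff[OF cl(1)])
    ultimately show False
      using cl by (auto simp: normal_deriv_def min_le_iff_disj)
  qed
  then show "u b - u a \<le> integral {a..b} P + e"
    using incr[of a b] assms \<open>\<epsilon> * (b - a) \<le> e\<close> by auto
qed

lemma subsolution_decrease_le:
  assumes u: "u \<in> lipschitz_subsolutions l r H" and "l \<le> a" "a \<le> b" "b \<le> r"
  shows "u a - u b \<le> integral {a..b} N"
proof (rule field_le_epsilon)
  fix e :: real assume "0 < e"
  define \<epsilon> where "\<epsilon> = e / (b - a + 1)"
  have "0 < \<epsilon>" "\<epsilon> * (b - a) \<le> e"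
    using \<open>0 < e\<close> \<open>a \<le> b\<close> by (auto simp: \<epsilon>_def field_simps)
  obtain \<phi> \<phi>' where C2: "has_C2_deriv_on \<phi> \<phi>' {l..r}"
    and slope: "\<And>x. x \<in> {l..r} \<Longrightarrow> \<phi>' x < - N x"
    and decr: "\<And>x y. l \<le> y \<Longrightarrow> y \<le> x \<Longrightarrow> x \<le> r \<Longrightarrow> \<phi> y - \<phi> x \<le> integral {y..x} N + \<epsilon> * (x - y)"
    using C2_slope_slightly_below[OF contN \<open>0 < \<epsilon>\<close>] by blast
  have u_cont: "continuous_on {l..r} u" and sub: "neumann_subsolution l r H u"
    using u unfolding lipschitz_subsolutions_def by (auto intro: lipschitz_on_continuous_on)
  have \<phi>_cont: "continuous_on {l..r} \<phi>"
    using C2 unfolding has_C2_deriv_on_def has_C1_deriv_on_def by (meson DERIV_continuous_on)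
  have "u a - \<phi> a \<le> u b - \<phi> b"
  proof (rule ccontr)
    assume less: "\<not> u a - \<phi> a \<le> u b - \<phi> b"
    have "continuous_on {l..b} (\<lambda>x. u x - \<phi> x)"
      by (rule continuous_on_subset[OF continuous_on_diff[OF u_cont \<phi>_cont]]) (use assms in auto)
    then obtain c where c: "c \<in> {l..b}" "\<And>z. z \<in> {l..b} \<Longrightarrow> u z - \<phi> z \<le> u c - \<phi> c"
      using continuous_attains_sup[OF compact_Icc, of l b "\<lambda>x. u x - \<phi> x"] assms by force
    have "c < b"
      using c(2)[of a] c(1) less assms by (cases "c = b") auto
    then have cl: "c \<in> {l..r}" "c < r" using c(1) assms by auto
    have "local_max_within {l..r} (\<lambda>x. u x - \<phi> x) c"
      by (rule local_max_within_of_max_on[of c "{l..b}" "{..<b}"]) (use c \<open>c < b\<close> in auto)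
    then have "(c \<in> {l<..<r} \<longrightarrow> H c (\<phi>' c) \<le> 0) \<and>
      (c \<in> {l, r} \<longrightarrow> min (H c (\<phi>' c)) (normal_deriv l c (\<phi>' c)) \<le> 0)"
      using sub C2 cl unfolding neumann_subsolution_def by blast
    moreover have "\<phi>' c < 0" "\<not> H c (\<phi>' c) \<le> 0"
      using slope[OF cl(1)] N_nonneg[OF cl(1)] by (auto simp: H_nonpos_iff[OF cl(1)])
    ultimately show False
      using cl by (auto simp: normal_deriv_def min_le_iff_disj)
  qed
  then show "u a - u b \<le> integral {a..b} N + e"
    using decr[of a b] assms \<open>\<epsilon> * (b - a) \<le> e\<close> by auto
qed

text \<open>
  The explicit form of the distance: the cost of going from \<open>y\<close> to \<open>x\<close> is \<open>P\<close> per unit length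
  to the right and \<open>N\<close> to the left.
\<close>

definition path_cost :: "real \<Rightarrow> real \<Rightarrow> real" where
  "path_cost x y = (if y \<le> x then integral {y..x} P else integral {x..y} N)"

theorem intrinsic_dist_eq:
  assumes x: "x \<in> {l..r}" and y: "y \<in> {l..r}"
  shows "intrinsic_dist l r H x y = ereal (path_cost x y)"
proof (rule antisym)
  show "intrinsic_dist l r H x y \<le> ereal (path_cost x y)"
    unfolding intrinsic_dist_def path_cost_def
    using x y subsolution_increase_le subsolution_decrease_le by (auto intro!: SUP_least)
  have "\<exists>u\<in>lipschitz_subsolutions l r H. u x - u y = path_cost x y"
  proof (cases "y \<le> x")
    case True
    have "(\<lambda>x. integral {l..x} P) \<in> lipschitz_subsolutions l r H"
      by (rule primitive_subsolution[OF contP]) (use N_nonneg P_nonneg in force)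
    then show ?thesis
      using integral_diff_Icc[OF contP, of y x] x y True by (force simp: path_cost_def)
  next
    case False
    have "(\<lambda>x. integral {l..x} (\<lambda>z. - N z)) \<in> lipschitz_subsolutions l r H"
      by (rule primitive_subsolution)
        (use contN N_nonneg P_nonneg in \<open>force intro: continuous_on_minus\<close>)+
    then show ?thesis
      using integral_diff_Icc[OF contN, of x y] x y False
      by (intro bexI[of _ "\<lambda>x. integral {l..x} (\<lambda>z. - N z)"]) (auto simp: path_cost_def)
  qed
  then show "ereal (path_cost x y) \<le> intrinsic_dist l r H x y"
    unfolding intrinsic_dist_def by (auto intro: SUP_upper2)
qed

subsection \<open>The Aubry set\<close>

lemma path_cost_eq_right:
  assumes "y \<in> {l..r}" "x \<in> {l..r}" "y \<le> x"
  shows "path_cost x y = integral {l..x} P - integral {l..y} P"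
  using integral_diff_Icc[OF contP, of y x] assms by (simp add: path_cost_def)

lemma path_cost_eq_left:
  assumes "y \<in> {l..r}" "x \<in> {l..r}" "x \<le> y"
  shows "path_cost x y = integral {l..y} N - integral {l..x} N"
  using integral_diff_Icc[OF contN, of x y] assms by (auto simp: path_cost_def)

lemma path_cost_deriv_right_of:
  assumes y: "y \<in> {l..r}" and x: "x \<in> {l..r}" and T: "x \<in> T" "T \<subseteq> {l..r}" and "0 < d"
    and near: "\<And>z. z \<in> T \<Longrightarrow> dist z x < d \<Longrightarrow> y \<le> z"
  shows "((\<lambda>z. path_cost z y) has_real_derivative P x) (at x within T)"
proof (rule has_field_derivative_transform_within[OF _ \<open>0 < d\<close> \<open>x \<in> T\<close>])
  show "((\<lambda>z. integral {l..z} P - integral {l..y} P) has_real_derivative P x) (at x within T)"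
    using DERIV_subset[OF integral_has_deriv_Icc[OF contP x] T(2)]
    by (auto intro!: derivative_eq_intros)
  show "integral {l..z} P - integral {l..y} P = path_cost z y" if "z \<in> T" "dist z x < d" for z
    using path_cost_eq_right[OF y _ near[OF that]] that T by auto
qed

lemma path_cost_deriv_left_of:
  assumes y: "y \<in> {l..r}" and x: "x \<in> {l..r}" and T: "x \<in> T" "T \<subseteq> {l..r}" and "0 < d"
    and near: "\<And>z. z \<in> T \<Longrightarrow> dist z x < d \<Longrightarrow> z \<le> y"
  shows "((\<lambda>z. path_cost z y) has_real_derivative - N x) (at x within T)"
proof (rule has_field_derivative_transform_within[OF _ \<open>0 < d\<close> \<open>x \<in> T\<close>])
  show "((\<lambda>z. integral {l..y} N - integral {l..z} N) has_real_derivative - N x) (at x within T)"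
    using DERIV_subset[OF integral_has_deriv_Icc[OF contN x] T(2)]
    by (auto intro!: derivative_eq_intros)
  show "integral {l..y} N - integral {l..z} N = path_cost z y" if "z \<in> T" "dist z x < d" for z
    using path_cost_eq_left[OF y _ near[OF that]] that T by auto
qed

lemma path_cost_right_deriv:
  assumes "y \<in> {l..r}" "x \<in> {l..r}"
  shows "((\<lambda>z. path_cost z y) has_real_derivative (if y \<le> x then P x else - N x))
           (at x within {x..r})"
proof (cases "y \<le> x")
  case True
  then show ?thesis
    using path_cost_deriv_right_of[OF assms, of "{x..r}" 1] assms by auto
next
  case False
  then show ?thesis
    using path_cost_deriv_left_of[OF assms, of "{x..r}" "y - x"] assms by (auto simp: dist_real_def)
qed

lemma path_cost_left_deriv:
  assumes "y \<in> {l..r}" "x \<in> {l..r}"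
  shows "((\<lambda>z. path_cost z y) has_real_derivative (if y < x then P x else - N x))
           (at x within {l..x})"
proof (cases "y < x")
  case True
  then show ?thesis
    using path_cost_deriv_right_of[OF assms, of "{l..x}" "x - y"] assms by (auto simp: dist_real_def)
next
  case False
  then show ?thesis
    using path_cost_deriv_left_of[OF assms, of "{l..x}" 1] assms by auto
qed

lemma local_min_path_cost_linear:
  assumes y: "y \<in> {l..r}" and "y < r \<Longrightarrow> p < P y" and "l < y \<Longrightarrow> - N y < p"
  shows "local_min_within {l..r} (\<lambda>x. path_cost x y - p * x) y"
  unfolding local_min_within_Icc_iff[OF y]
proof
  have lin: "((\<lambda>x. p * x) has_real_derivative p) (at y within T)" for T
    by (auto intro!: derivative_eq_intros)
  show "\<forall>\<^sub>F z in at y within {l..y}. path_cost y y - p * y \<le> path_cost z y - p * z"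
  proof (cases "l < y")
    case True
    show ?thesis
      by (rule left_min_of_deriv_neg[OF DERIV_diff[OF path_cost_left_deriv[OF y y] lin]])
        (use True assms in auto)
  next
    case False
    then show ?thesis using y by (auto simp: eventually_at_filter)
  qed
  show "\<forall>\<^sub>F z in at y within {y..r}. path_cost y y - p * y \<le> path_cost z y - p * z"
  proof (cases "y < r")
    case True
    show ?thesis
      by (rule right_min_of_deriv_pos[OF DERIV_diff[OF path_cost_right_deriv[OF y y] lin]])
        (use True assms in auto)
  next
    case False
    then show ?thesis using y by (auto simp: eventually_at_filter)
  qed
qed

text \<open>
  Only the behaviour at \<open>y\<close> itself can obstruct the supersolution property.  At the end point \<open>l\<close>
  only \<open>P\<close> matters, and at \<open>r\<close> only \<open>N\<close>, since the Neumann condition admits all outward slopes.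
\<close>

lemma path_cost_supersolution_iff:
  assumes y: "y \<in> {l..r}"
  shows "neumann_supersolution l r H (\<lambda>x. path_cost x y) \<longleftrightarrow>
    (y < r \<longrightarrow> P y = 0) \<and> (l < y \<longrightarrow> N y = 0)"
proof
  assume super: "neumann_supersolution l r H (\<lambda>x. path_cost x y)"
  have test: "(y \<in> {l<..<r} \<longrightarrow> 0 \<le> H y p) \<and>
      (y \<in> {l, r} \<longrightarrow> 0 \<le> max (H y p) (normal_deriv l y p))"
    if "y < r \<Longrightarrow> p < P y" "l < y \<Longrightarrow> - N y < p" for p
    using super has_C2_deriv_on_linear[of p] local_min_path_cost_linear[OF y that] y
    unfolding neumann_supersolution_def by blast
  show "(y < r \<longrightarrow> P y = 0) \<and> (l < y \<longrightarrow> N y = 0)"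
  proof (rule ccontr)
    assume neg: "\<not> ?thesis"
    \<comment> \<open>The midpoint of \<open>[- N y, P y]\<close> if \<open>y\<close> is interior; at an end point, the midpoint of the half of
      this interval that consists of the inward slopes, because outward slopes are always admitted.\<close>
    define p where "p = ((if y < r then P y else 0) - (if l < y then N y else 0)) / 2"
    have nonneg: "0 \<le> N y" "0 \<le> P y" using N_nonneg[OF y] P_nonneg[OF y] by auto
    have p: "y < r \<Longrightarrow> p < P y" "l < y \<Longrightarrow> - N y < p" "y = l \<Longrightarrow> 0 < p" "y = r \<Longrightarrow> p < 0"
      using neg nonneg lr by (auto simp: p_def)
    have "H y p < 0"
      using p nonneg y by (cases "y = l"; cases "y = r") (auto simp: H_neg_iff)
    then show False
      using test[of p] p y by (cases "y = l"; cases "y = r") (auto simp: normal_deriv_def)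
  qed
next
  assume cond: "(y < r \<longrightarrow> P y = 0) \<and> (l < y \<longrightarrow> N y = 0)"
  show "neumann_supersolution l r H (\<lambda>x. path_cost x y)"
    unfolding neumann_supersolution_def
  proof (intro allI impI ballI)
    fix \<phi> \<phi>' c
    assume C2: "has_C2_deriv_on \<phi> \<phi>' {l..r}" and c: "c \<in> {l..r}"
      and min: "local_min_within {l..r} (\<lambda>x. path_cost x y - \<phi> x) c"
    have \<phi>: "(\<phi> has_real_derivative \<phi>' c) (at c within {l..r})"
      using C2 c unfolding has_C2_deriv_on_def has_C1_deriv_on_def by auto
    have right: "\<phi>' c \<le> (if y \<le> c then P c else - N c)" if "c < r"
      using test_slope_le_right_deriv[OF min c that path_cost_right_deriv[OF y c] \<phi>] .
    have left: "(if y < c then P c else - N c) \<le> \<phi>' c" if "l < c"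
      using left_deriv_le_test_slope[OF min c that path_cost_left_deriv[OF y c] \<phi>] .
    have nonneg: "0 \<le> N c" "0 \<le> P c" using N_nonneg[OF c] P_nonneg[OF c] by auto
    show "(c \<in> {l<..<r} \<longrightarrow> 0 \<le> H c (\<phi>' c)) \<and>
      (c \<in> {l, r} \<longrightarrow> 0 \<le> max (H c (\<phi>' c)) (normal_deriv l c (\<phi>' c)))"
    proof (intro conjI impI)
      assume "c \<in> {l<..<r}"
      then have "\<not> H c (\<phi>' c) < 0"
        using left right cond H_neg_iff[OF c] by (auto split: if_splits)
      then show "0 \<le> H c (\<phi>' c)" by simp
    next
      assume "c \<in> {l, r}"
      then have "0 \<le> normal_deriv l c (\<phi>' c)"
        using left right cond nonneg lr y by (auto simp: normal_deriv_def split: if_splits)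
      then show "0 \<le> max (H c (\<phi>' c)) (normal_deriv l c (\<phi>' c))" by simp
    qed
  qed
qed

text \<open>The points where the zero sublevel is reduced to \<open>{0}\<close>.\<close>

definition degenerate_set :: "real set" where
  "degenerate_set = {x \<in> {l..r}. N x = 0 \<and> P x = 0}"

theorem neumann_aubry_eq:
  "neumann_aubry l r H =
     degenerate_set \<union> (if P l = 0 then {l} else {}) \<union> (if N r = 0 then {r} else {})"
proof -
  have "neumann_aubry l r H = {y \<in> {l..r}. neumann_supersolution l r H (\<lambda>x. path_cost x y)}"
    unfolding neumann_aubry_def
  proof (intro Collect_cong conj_cong refl)
    fix y assume y: "y \<in> {l..r}"
    have "neumann_supersolution l r H (\<lambda>x. real_of_ereal (intrinsic_dist l r H x y)) \<longleftrightarrow>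
        neumann_supersolution l r H (\<lambda>x. path_cost x y)"
      by (rule neumann_supersolution_cong) (simp add: intrinsic_dist_eq[OF _ y])
    then show "(\<forall>x\<in>{l..r}. \<bar>intrinsic_dist l r H x y\<bar> \<noteq> \<infinity>) \<and>
        neumann_supersolution l r H (\<lambda>x. real_of_ereal (intrinsic_dist l r H x y)) \<longleftrightarrow>
        neumann_supersolution l r H (\<lambda>x. path_cost x y)"
      using y by (simp add: intrinsic_dist_eq)
  qed
  also have "\<dots> = {y \<in> {l..r}. (y < r \<longrightarrow> P y = 0) \<and> (l < y \<longrightarrow> N y = 0)}"
    using path_cost_supersolution_iff by blast
  also have "\<dots> = degenerate_set \<union> (if P l = 0 then {l} else {}) \<union> (if N r = 0 then {r} else {})"
    using lr by (auto simp: degenerate_set_def)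
  finally show ?thesis .
qed

subsection \<open>Static classes\<close>

lemma path_cost_round_trip_zero_iff:
  assumes x: "x \<in> {l..r}" and y: "y \<in> {l..r}"
  shows "path_cost x y + path_cost y x = 0 \<longleftrightarrow> x = y \<or> closed_segment x y \<subseteq> degenerate_set"
proof -
  have less: "path_cost x y + path_cost y x = 0 \<longleftrightarrow> {x..y} \<subseteq> degenerate_set"
    if "x < y" "x \<in> {l..r}" "y \<in> {l..r}" for x y
  proof -
    have sub: "{x..y} \<subseteq> {l..r}" using that by auto
    have cont: "continuous_on {x..y} N" "continuous_on {x..y} P"
      using contN contP sub by (auto intro: continuous_on_subset)
    have nonneg: "0 \<le> integral {x..y} N" "0 \<le> integral {x..y} P"
      using cont sub N_nonneg P_nonneg
      by (auto intro!: integral_nonneg integrable_continuous_interval)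
    have "path_cost x y + path_cost y x = integral {x..y} N + integral {x..y} P"
      using \<open>x < y\<close> by (simp add: path_cost_def)
    then have "path_cost x y + path_cost y x = 0 \<longleftrightarrow>
        integral {x..y} N = 0 \<and> integral {x..y} P = 0"
      using nonneg by auto
    also have "\<dots> \<longleftrightarrow> (\<forall>z\<in>{x..y}. N z = 0) \<and> (\<forall>z\<in>{x..y}. P z = 0)"
      using integral_eq_0_iff[OF cont(1) \<open>x < y\<close>] integral_eq_0_iff[OF cont(2) \<open>x < y\<close>]
        sub N_nonneg P_nonneg by (simp add: subset_iff)
    also have "\<dots> \<longleftrightarrow> {x..y} \<subseteq> degenerate_set"
      using sub by (auto simp: degenerate_set_def)
    finally show ?thesis .
  qed
  consider "x = y" | "x < y" | "y < x" by linarith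
  then show ?thesis
  proof cases
    case 1
    then show ?thesis by (simp add: path_cost_def)
  next
    case 2
    then show ?thesis using less[OF 2 x y] by (simp add: closed_segment_eq_real_ivl)
  next
    case 3
    then show ?thesis using less[OF 3 y x] by (simp add: closed_segment_eq_real_ivl add.commute)
  qed
qed

lemma static_class_of:
  assumes "x \<in> neumann_aubry l r H"
  shows "{y \<in> neumann_aubry l r H. y = x \<or> closed_segment x y \<subseteq> degenerate_set}
           \<in> static_classes l r H"
proof -
  let ?A = "neumann_aubry l r H"
  let ?R = "{(x, y). x \<in> ?A \<and> y \<in> ?A \<and> intrinsic_dist l r H x y + intrinsic_dist l r H y x = 0}"
  have sub: "?A \<subseteq> {l..r}" by (auto simp: neumann_aubry_def)
  have "intrinsic_dist l r H x y + intrinsic_dist l r H y x = 0 \<longleftrightarrow>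
      y = x \<or> closed_segment x y \<subseteq> degenerate_set" if "y \<in> ?A" for y
  proof -
    have xy: "x \<in> {l..r}" "y \<in> {l..r}" using sub assms that by auto
    show ?thesis
      using path_cost_round_trip_zero_iff[OF xy] xy
      by (auto simp: intrinsic_dist_eq zero_ereal_def)
  qed
  then have "?R `` {x} = {y \<in> ?A. y = x \<or> closed_segment x y \<subseteq> degenerate_set}"
    using assms by auto
  moreover have "?R `` {x} \<in> ?A // ?R"
    using assms by (rule quotientI)
  ultimately show ?thesis
    by (simp add: static_classes_def)
qed

lemma connected_component_real_iff:
  fixes S :: "real set"
  shows "connected_component S x y \<longleftrightarrow> closed_segment x y \<subseteq> S"
proof
  assume "connected_component S x y"
  then obtain T where "connected T" "T \<subseteq> S" "x \<in> T" "y \<in> T"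
    by (auto simp: connected_component_def)
  then show "closed_segment x y \<subseteq> S"
    by (metis closed_segment_subset is_interval_connected_1 is_interval_convex_1 order_trans)
next
  assume "closed_segment x y \<subseteq> S"
  then show "connected_component S x y"
    unfolding connected_component_def by (intro exI[of _ "closed_segment x y"]) auto
qed

theorem component_static_class:
  assumes "C \<in> components degenerate_set"
  shows "C \<in> static_classes l r H"
proof -
  obtain x where x: "x \<in> degenerate_set" and C: "C = {y. closed_segment x y \<subseteq> degenerate_set}"
    using assms unfolding components_iff connected_component_real_iff by blast
  have sub: "degenerate_set \<subseteq> neumann_aubry l r H"
    by (auto simp: neumann_aubry_eq)
  have "C = {y \<in> neumann_aubry l r H. y = x \<or> closed_segment x y \<subseteq> degenerate_set}"
    unfolding C using x sub by auto
  then show ?thesis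
    using static_class_of[of x] x sub by auto
qed

theorem singleton_static_class:
  assumes "e \<in> neumann_aubry l r H - degenerate_set"
  shows "{e} \<in> static_classes l r H"
proof -
  have "{y \<in> neumann_aubry l r H. y = e \<or> closed_segment e y \<subseteq> degenerate_set} = {e}"
    using assms by auto
  then show ?thesis
    using static_class_of[of e] assms by auto
qed

end

section \<open>The maximum of two quadratic Hamiltonians\<close>

lemma max_hamiltonian_nonneg_slope:
  "p \<ge> 0 \<Longrightarrow> max_hamiltonian b1 b2 x p = p\<^sup>2 - b_minus b1 b2 x * p"
  using mult_right_mono[of "b1 x" "b2 x" p] mult_right_mono[of "b2 x" "b1 x" p]
  unfolding max_hamiltonian_def b_minus_def by (cases "b1 x \<le> b2 x") auto

lemma max_hamiltonian_nonpos_slope: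
  "p \<le> 0 \<Longrightarrow> max_hamiltonian b1 b2 x p = p\<^sup>2 - b_plus b1 b2 x * p"
  using mult_right_mono_neg[of "b1 x" "b2 x" p] mult_right_mono_neg[of "b2 x" "b1 x" p]
  unfolding max_hamiltonian_def b_plus_def by (cases "b1 x \<le> b2 x") auto

lemma b_minus_le_b_plus: "b_minus b1 b2 x \<le> b_plus b1 b2 x"
  by (simp add: b_minus_def b_plus_def)

lemma max_hamiltonian_nonpos_iff:
  "max_hamiltonian b1 b2 x p \<le> 0 \<longleftrightarrow>
     - max (- b_plus b1 b2 x) 0 \<le> p \<and> p \<le> max (b_minus b1 b2 x) 0"
proof (cases p "0::real" rule: linorder_cases)
  case less
  then have "max_hamiltonian b1 b2 x p = p * (p - b_plus b1 b2 x)"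
    by (simp add: max_hamiltonian_nonpos_slope power2_eq_square algebra_simps)
  then show ?thesis using less by (auto simp: mult_le_0_iff)
next
  case equal
  then show ?thesis by (simp add: max_hamiltonian_def)
next
  case greater
  then have "max_hamiltonian b1 b2 x p = p * (p - b_minus b1 b2 x)"
    by (simp add: max_hamiltonian_nonneg_slope power2_eq_square algebra_simps)
  then show ?thesis using greater by (auto simp: mult_le_0_iff)
qed

lemma max_hamiltonian_neg_iff:
  "max_hamiltonian b1 b2 x p < 0 \<longleftrightarrow>
     - max (- b_plus b1 b2 x) 0 < p \<and> p < max (b_minus b1 b2 x) 0"
proof (cases p "0::real" rule: linorder_cases)
  case less
  then have "max_hamiltonian b1 b2 x p = p * (p - b_plus b1 b2 x)"
    by (simp add: max_hamiltonian_nonpos_slope power2_eq_square algebra_simps)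
  then show ?thesis using less by (auto simp: mult_less_0_iff)
next
  case equal
  \<comment> \<open>Here the left-hand side is false; so is the right-hand side, which would give
    \<open>b\<^sub>+ < 0 < b\<^sub>-\<close>.\<close>
  then show ?thesis
    using b_minus_le_b_plus[of b1 b2 x] by (auto simp: max_hamiltonian_def less_max_iff_disj)
next
  case greater
  then have "max_hamiltonian b1 b2 x p = p * (p - b_minus b1 b2 x)"
    by (simp add: max_hamiltonian_nonneg_slope power2_eq_square algebra_simps)
  then show ?thesis using greater by (auto simp: mult_less_0_iff)
qed

lemma C1_on_imp_continuous_on: "C1_on S f \<Longrightarrow> continuous_on S f"
  unfolding C1_on_def has_C1_deriv_on_def by (meson DERIV_continuous_on)

lemma interval_hamiltonian_max:
  assumes "l < r" "continuous_on {l..r} b1" "continuous_on {l..r} b2"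
  shows "interval_hamiltonian l r (max_hamiltonian b1 b2)
    (\<lambda>x. max (- b_plus b1 b2 x) 0) (\<lambda>x. max (b_minus b1 b2 x) 0)"
proof
  show "continuous_on {l..r} (\<lambda>x. max (- b_plus b1 b2 x) 0)"
    "continuous_on {l..r} (\<lambda>x. max (b_minus b1 b2 x) 0)"
    unfolding b_plus_def b_minus_def using assms by (intro continuous_intros; simp)+
qed (use assms max_hamiltonian_nonpos_iff max_hamiltonian_neg_iff in auto)

theorem theorem2p2:
  fixes l r :: real and b1 b2 :: "real \<Rightarrow> real"
  assumes "l < r" and "C1_on {l..r} b1" and "C1_on {l..r} b2"
  shows
    "(\<forall>x\<in>{l..r}. \<forall>p.
        (p \<ge> 0 \<longrightarrow> max_hamiltonian b1 b2 x p = p\<^sup>2 - b_minus b1 b2 x * p) \<and>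
        (p \<le> 0 \<longrightarrow> max_hamiltonian b1 b2 x p = p\<^sup>2 - b_plus b1 b2 x * p)) \<and>
     (\<forall>x\<in>{l..r}. {p. max_hamiltonian b1 b2 x p \<le> 0} =
        {min (b_plus b1 b2 x) 0 .. max (b_minus b1 b2 x) 0}) \<and>
     (\<forall>x\<in>{l..r}. \<forall>\<xi>\<in>{l..r}.
        (x \<ge> \<xi> \<longrightarrow> intrinsic_dist l r (max_hamiltonian b1 b2) x \<xi> =
           ereal (integral {\<xi>..x} (\<lambda>s. max (b_minus b1 b2 s) 0))) \<and>
        (x \<le> \<xi> \<longrightarrow> intrinsic_dist l r (max_hamiltonian b1 b2) x \<xi> =
           ereal (integral {x..\<xi>} (\<lambda>s. max (- b_plus b1 b2 s) 0)))) \<and>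
     {x\<in>{l..r}. {p. max_hamiltonian b1 b2 x p \<le> 0} = {0}} = A_zero l r b1 b2 \<and>
     neumann_aubry l r (max_hamiltonian b1 b2) =
       A_zero l r b1 b2 \<union> (if b_minus b1 b2 l \<le> 0 then {l} else {})
                        \<union> (if b_plus b1 b2 r \<ge> 0 then {r} else {}) \<and>
     (\<forall>C\<in>components (A_zero l r b1 b2). C \<in> static_classes l r (max_hamiltonian b1 b2)) \<and>
     (\<forall>e\<in>neumann_aubry l r (max_hamiltonian b1 b2) - A_zero l r b1 b2.
        {e} \<in> static_classes l r (max_hamiltonian b1 b2))"
proof -
  interpret interval_hamiltonian l r "max_hamiltonian b1 b2"
    "\<lambda>x. max (- b_plus b1 b2 x) 0" "\<lambda>x. max (b_minus b1 b2 x) 0"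
    using assms by (intro interval_hamiltonian_max C1_on_imp_continuous_on)
  have sublevel: "{p. max_hamiltonian b1 b2 x p \<le> 0} =
      {min (b_plus b1 b2 x) 0 .. max (b_minus b1 b2 x) 0}" for x
    by (auto simp: max_hamiltonian_nonpos_iff)
  have product: "b1 x * b2 x \<le> 0 \<longleftrightarrow> b_minus b1 b2 x \<le> 0 \<and> 0 \<le> b_plus b1 b2 x" for x
    by (auto simp: mult_le_0_iff b_minus_def b_plus_def)
  have degenerate: "degenerate_set = A_zero l r b1 b2"
    unfolding degenerate_set_def A_zero_def product by auto
  have reduced: "{min (b_plus b1 b2 x) 0 .. max (b_minus b1 b2 x) 0} = {0} \<longleftrightarrow> b1 x * b2 x \<le> 0" for x
    unfolding product by (auto simp: atLeastAtMost_singleton_iff)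
  have ends: "(max (b_minus b1 b2 l) 0 = 0) = (b_minus b1 b2 l \<le> 0)"
    "(max (- b_plus b1 b2 r) 0 = 0) = (b_plus b1 b2 r \<ge> 0)"
    by auto
  show ?thesis
  proof (intro conjI ballI allI impI)
    fix x \<xi> assume x: "x \<in> {l..r}" and \<xi>: "\<xi> \<in> {l..r}"
    show "intrinsic_dist l r (max_hamiltonian b1 b2) x \<xi> =
        ereal (integral {\<xi>..x} (\<lambda>s. max (b_minus b1 b2 s) 0))" if "\<xi> \<le> x"
      using that intrinsic_dist_eq[OF x \<xi>] by (simp add: path_cost_def)
    show "intrinsic_dist l r (max_hamiltonian b1 b2) x \<xi> =
        ereal (integral {x..\<xi>} (\<lambda>s. max (- b_plus b1 b2 s) 0))" if "x \<le> \<xi>"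
      using that intrinsic_dist_eq[OF x \<xi>] by (cases "x = \<xi>") (auto simp: path_cost_def)
  next
    show "{x\<in>{l..r}. {p. max_hamiltonian b1 b2 x p \<le> 0} = {0}} = A_zero l r b1 b2"
      unfolding sublevel reduced A_zero_def ..
    show "neumann_aubry l r (max_hamiltonian b1 b2) =
       A_zero l r b1 b2 \<union> (if b_minus b1 b2 l \<le> 0 then {l} else {})
                        \<union> (if b_plus b1 b2 r \<ge> 0 then {r} else {})"
      using neumann_aubry_eq unfolding degenerate ends .
  qed (use max_hamiltonian_nonneg_slope max_hamiltonian_nonpos_slope sublevel
      component_static_class singleton_static_class degenerate in auto)
qed

end
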